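(* Let $K$ be a closed convex cone in a finite dimensional Euclidean space $X$. The following statements hold. (1) If $K$ is nice, then it is facially exposed. (2) If $K$ is facially exposed, and for all faces $F$ of $K$ all properly minimal faces of $F^*$ are exposed faces of $F^*$, then $K$ is nice.
   Context: All spaces are finite dimensional Euclidean spaces with inner product $\langle\cdot,\cdot\rangle$. A cone is a nonempty set $C$ with $\lambda x\in C$ for all $x\in C$, $\lambda\ge 0$. For a convex cone $C\subseteq X$: the dual cone is $C^*=\{y\in X : \langle y,x\rangle\ge 0 \ \forall x\in C\}$; the lineality space is $\operatorname{lspace} C = C\cap(-C)$. For a set $S$, $S^\perp$ is the orthogonal complement in $X$ of the linear span of $S$ (and $y^\perp=\{y\}^\perp$). For a face $F$ of $K$, $F^*$ is the dual cone of $F$ taken in the whole space $X$. A nonempty convex subset $E$ of a closed convex cone $C$ is a face of $C$ if $x_1,x_2\in C$ and $x_1+x_2\in E$ imply $x_1,x_2\in E$; equivalently, whenever the open line segment between $x_1,x_2\in C$ meets $E$, both $x_1,x_2\in E$. The cone $C$ itself is a face, and $\operatorname{lspace} C$ is the inclusionwise smallest face. A face $E$ of $C$ is properly minimal if $E\neq \operatorname{lspace} C$ and there is no face $E'$ of $C$ with $\operatorname{lspace} C\subsetneq E'\subsetneq E$. A face $E$ of $C$ is exposed if $E=C\cap y^\perp$ for some $y\in C^*$ ($y=0$ is allowed, so $C$ is an exposed face of itself). $C$ is facially exposed if all of its faces are exposed. A closed convex cone $K$ is nice if the set $K^*+F^\perp$ is closed for all faces $F$ of $K$ (equivalently, $F^*=K^*+F^\perp$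 for all faces $F$ of $K$). *)

theory Defs
  imports "HOL-Analysis.Analysis"
begin

lemma orthogonal_comp_span: "(span S)\<^sup>\<bottom> = (S::'a::euclidean_space set)\<^sup>\<bottom>"
proof
  show "(span S)\<^sup>\<bottom> \<subseteq> S\<^sup>\<bottom>"
    by (rule orthogonal_comp_anti_mono) (rule span_superset)
  show "S\<^sup>\<bottom> \<subseteq> (span S)\<^sup>\<bottom>"
    unfolding orthogonal_comp_def
    by (auto intro: orthogonal_commute[THEN iffD1] orthogonal_to_span simp: orthogonal_commute)
qed

definition dual_cone :: "'a::euclidean_space set \<Rightarrow> 'a set" where
  "dual_cone C = {y. \<forall>x\<in>C. y \<bullet> x \<ge> 0}"

text \<open>The negation is an image: on sets, unary minus is the complement.\<close>

definition lspace :: "'a::euclidean_space set \<Rightarrow> 'a set" where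
  "lspace C = C \<inter> uminus ` C"

text \<open>
  The library relation \<open>face_of\<close> is the open-segment definition and admits the empty
  set, which is not a face here. The variant "\<open>x1 + x2 \<in> E\<close> implies
  \<open>x1, x2 \<in> E\<close>" agrees with it only for subcones \<open>E\<close>:
  in the half-line \<open>{0..}\<close> the interval \<open>{0..1}\<close> satisfies the
  variant but is not a face.
\<close>

definition cone_face_of :: "'a::euclidean_space set \<Rightarrow> 'a set \<Rightarrow> bool"
    (infix \<open>cone'_face'_of\<close> 50) where
  "E cone_face_of C \<longleftrightarrow> E face_of C \<and> E \<noteq> {}"

definition properly_minimal_face_of :: "'a::euclidean_space set \<Rightarrow> 'a set \<Rightarrow> bool"
    (infix \<open>properly'_minimal'_face'_of\<close> 50) where
  "E properly_minimal_face_of C \<longleftrightarrow>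
     E cone_face_of C \<and> E \<noteq> lspace C \<and>
     \<not> (\<exists>E'. E' cone_face_of C \<and> lspace C \<subset> E' \<and> E' \<subset> E)"

text \<open>
  The library relation \<open>exposed_face_of\<close> allows arbitrary affine supporting
  hyperplanes and the empty set; the lemma below compares the two.
\<close>

definition cone_exposed_face_of :: "'a::euclidean_space set \<Rightarrow> 'a set \<Rightarrow> bool"
    (infix \<open>cone'_exposed'_face'_of\<close> 50) where
  "E cone_exposed_face_of C \<longleftrightarrow>
     E cone_face_of C \<and> (\<exists>y\<in>dual_cone C. E = C \<inter> {y}\<^sup>\<bottom>)"

lemma cone_exposed_face_of_iff:
  fixes C :: "'a::euclidean_space set"
  assumes "convex_cone C"
  shows "E cone_exposed_face_of C \<longleftrightarrow> E exposed_face_of C \<and> E \<noteq> {}"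
proof
  assume "E cone_exposed_face_of C"
  then obtain y where y: "E face_of C" "E \<noteq> {}" "y \<in> dual_cone C" "E = C \<inter> {y}\<^sup>\<bottom>"
    by (auto simp: cone_exposed_face_of_def cone_face_of_def)
  have "C \<subseteq> {x. (-y) \<bullet> x \<le> 0}" "E = C \<inter> {x. (-y) \<bullet> x = 0}"
    using y by (auto simp: dual_cone_def orthogonal_comp_def orthogonal_def)
  with y show "E exposed_face_of C \<and> E \<noteq> {}"
    unfolding exposed_face_of_def by blast
next
  assume "E exposed_face_of C \<and> E \<noteq> {}"
  then obtain a b where ab: "E face_of C" "E \<noteq> {}"
      "C \<subseteq> {x. a \<bullet> x \<le> b}" "E = C \<inter> {x. a \<bullet> x = b}"
    by (auto simp: exposed_face_of_def)
  have scale: "c *\<^sub>R x \<in> C" if "x \<in> C" "c \<ge> 0" for c x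
    using assms that by (simp add: convex_cone_iff)
  obtain e where e: "e \<in> C" "a \<bullet> e = b" using ab by auto
  have "2 * b \<le> b" using scale[of e 2] e ab(3) by auto
  moreover have "0 \<le> b" using scale[of e 0] e ab(3) by auto
  ultimately have b: "b = 0" by simp
  have "-a \<in> dual_cone C" "E = C \<inter> {-a}\<^sup>\<bottom>"
    using ab b by (auto simp: dual_cone_def orthogonal_comp_def orthogonal_def)
  with ab show "E cone_exposed_face_of C"
    unfolding cone_exposed_face_of_def cone_face_of_def by blast
qed

definition facially_exposed :: "'a::euclidean_space set \<Rightarrow> bool" where
  "facially_exposed C \<longleftrightarrow> (\<forall>E. E cone_face_of C \<longrightarrow> E cone_exposed_face_of C)"

text \<open>Here \<open>+\<close> is the elementwise sum of sets.\<close>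

definition nice_cone :: "'a::euclidean_space set \<Rightarrow> bool" where
  "nice_cone K \<longleftrightarrow> (\<forall>F. F cone_face_of K \<longrightarrow> closed (dual_cone K + F\<^sup>\<bottom>))"

end

theory Submission
  imports Defs
begin

text \<open>
  Write \<open>F\<^sup>*\<close> for the dual cone of \<open>F\<close>. For every face \<open>F\<close> of \<open>K\<close> the cone
  \<open>K\<^sup>* + F\<^sup>\<bottom>\<close> is a dense subset of \<open>F\<^sup>*\<close>, so niceness says that every functional
  nonnegative on \<open>F\<close> agrees on \<open>F\<close> with one nonnegative on all of \<open>K\<close>.

  A nice cone is facially exposed: let \<open>E\<close> be the smallest exposed face containing
  \<open>F\<close>. If \<open>F\<close> were a proper face of \<open>E\<close>, some functional in \<open>E\<^sup>*\<close> would
  vanish on \<open>F\<close> and not on \<open>E\<close>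
  (\<open>proper_cone_face_supporting\<close>); by niceness at \<open>E\<close> it agrees on \<open>E\<close> with
  a member of \<open>K\<^sup>*\<close>, which exposes a face still containing \<open>F\<close> but not
  \<open>E\<close>.

  In the other direction, a Krein-Milman argument generates \<open>F\<^sup>*\<close> by its lineality space
  \<open>F\<^sup>\<bottom>\<close> and its properly minimal faces (\<open>dual_cone_subset_if_minimal_faces\<close>), each
  of which is \<open>F\<^sup>\<bottom>\<close> plus a ray through some \<open>e\<close> with \<open>e \<notin> F\<^sup>\<bottom>\<close>.
  By assumption such a face is exposed by some \<open>x\<close>, which lies in \<open>F\<close> because \<open>F\<close> is its own bidual. The zeros of
  \<open>e\<close> in \<open>F\<close> form a face of \<open>K\<close> containing \<open>x\<close>, and a member of \<open>K\<^sup>*\<close> exposing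
  it must be a positive multiple of \<open>e\<close> modulo \<open>F\<^sup>\<bottom>\<close>
  (\<open>exposed_minimal_face_in_sum\<close>). Hence \<open>F\<^sup>* = K\<^sup>* + F\<^sup>\<bottom>\<close>, which is closed.
\<close>

section \<open>Dual cones and orthogonal complements\<close>

lemma mem_dual_cone: "y \<in> dual_cone C \<longleftrightarrow> (\<forall>x\<in>C. 0 \<le> y \<bullet> x)"
  by (simp add: dual_cone_def)

lemma mem_orthogonal_comp: "y \<in> S\<^sup>\<bottom> \<longleftrightarrow> (\<forall>x\<in>S. y \<bullet> x = 0)"
  by (auto simp: orthogonal_comp_def orthogonal_def inner_commute)

lemma dual_cone_antimono: "A \<subseteq> B \<Longrightarrow> dual_cone B \<subseteq> dual_cone A"
  by (auto simp: dual_cone_def)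

lemma convex_cone_dual_cone: "convex_cone (dual_cone C)"
  by (simp add: convex_cone_iff mem_dual_cone inner_simps)

lemma convex_cone_orthogonal_comp: "convex_cone ((S::'a::euclidean_space set)\<^sup>\<bottom>)"
  by (simp add: convex_cone_iff mem_orthogonal_comp inner_simps)

lemma closed_dual_cone: "closed (dual_cone C)"
proof -
  have "dual_cone C = (\<Inter>x\<in>C. {y. 0 \<le> x \<bullet> y})"
    by (auto simp: dual_cone_def inner_commute)
  then show ?thesis
    by (simp add: closed_INT closed_halfspace_ge)
qed

lemma convex_cone_set_plus:
  assumes "convex_cone A" "convex_cone B"
  shows "convex_cone (A + B)"
proof -
  have "A + B = (\<Union>x\<in>A. \<Union>y\<in>B. {x + y})"
    by (auto simp: set_plus_def)
  then show ?thesis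
    using convex_cone_sums[OF assms] by simp
qed

lemma set_plus_subset_dual_cone:
  assumes "F \<subseteq> K"
  shows "dual_cone K + F\<^sup>\<bottom> \<subseteq> dual_cone F"
proof
  fix y assume "y \<in> dual_cone K + F\<^sup>\<bottom>"
  then obtain u v where "y = u + v" "u \<in> dual_cone K" "v \<in> F\<^sup>\<bottom>"
    by (rule set_plus_elim)
  with assms show "y \<in> dual_cone F"
    by (auto simp: mem_dual_cone mem_orthogonal_comp inner_simps)
qed

lemma lspace_dual_cone: "lspace (dual_cone C) = C\<^sup>\<bottom>"
proof -
  have "y \<in> lspace (dual_cone C) \<longleftrightarrow> y \<in> dual_cone C \<and> - y \<in> dual_cone C" for y
    unfolding lspace_def by (metis IntD1 IntD2 IntI equation_minus_iff image_iff)
  then show ?thesis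
    by (force simp: mem_dual_cone mem_orthogonal_comp set_eq_iff intro: antisym)
qed

text \<open>
  A hyperplane separating a point from a closed convex cone may be taken through the origin:
  a linear functional bounded below on a cone is nonnegative on it.
\<close>

lemma closed_convex_cone_separation:
  assumes "closed C" "convex_cone C" "z \<notin> C"
  obtains a where "a \<in> dual_cone C" "a \<bullet> z < 0"
proof -
  have "convex C" "C \<noteq> {}"
    using assms(2) by (auto simp: convex_cone_def)
  then obtain a b where ab: "a \<bullet> z < b" "\<forall>x\<in>C. b < a \<bullet> x"
    using separating_hyperplane_closed_point[of C z] assms by blast
  have "b < 0"
    using ab(2) convex_cone_contains_0[OF assms(2)] by force
  have "0 \<le> a \<bullet> x" if "x \<in> C" for x
  proof (rule ccontr)
    assume neg: "\<not> 0 \<le> a \<bullet> x"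
    \<comment> \<open>The multiple of \<open>x\<close> at which the functional takes the value \<open>b\<close>.\<close>
    have "(b / (a \<bullet> x)) *\<^sub>R x \<in> C"
      using neg \<open>b < 0\<close> by (intro convex_cone_scaleR assms that) (simp add: divide_nonpos_neg)
    then show False
      using ab(2) neg by fastforce
  qed
  then show ?thesis
    using that ab(1) \<open>b < 0\<close> by (force simp: mem_dual_cone)
qed

lemma dual_cone_dual_cone:
  assumes "closed C" "convex_cone C"
  shows "dual_cone (dual_cone C) = C"
proof
  show "C \<subseteq> dual_cone (dual_cone C)"
    unfolding dual_cone_def by (auto intro: ord_le_eq_trans[OF _ inner_commute])
  show "dual_cone (dual_cone C) \<subseteq> C"
  proof
    fix z assume z: "z \<in> dual_cone (dual_cone C)"
    show "z \<in> C"
    proof (rule ccontr)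
      assume "z \<notin> C"
      then obtain a where "a \<in> dual_cone C" "a \<bullet> z < 0"
        using closed_convex_cone_separation assms by blast
      with z show False
        by (force simp: mem_dual_cone inner_commute)
    qed
  qed
qed

lemma dual_cone_decomposition:
  assumes "y \<in> dual_cone C"
  obtains d l where "y = d + l" "d \<in> dual_cone C" "d \<in> span C" "l \<in> C\<^sup>\<bottom>"
proof -
  obtain d l where dl: "d \<in> span C" "\<And>w. w \<in> span C \<Longrightarrow> orthogonal l w" "y = d + l"
    using orthogonal_subspace_decomp_exists[of C y] by blast
  then have l: "l \<in> C\<^sup>\<bottom>"
    by (simp add: mem_orthogonal_comp orthogonal_def span_base)
  with dl assms have "d \<in> dual_cone C"
    by (simp add: mem_dual_cone mem_orthogonal_comp inner_simps)
  with dl l that show ?thesis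
    by blast
qed

section \<open>Points in the relative interior of a cone\<close>

text \<open>
  Moving from a relatively interior point \<open>b\<close> a fixed distance in the direction opposite
  to \<open>y\<close> stays inside the cone, where \<open>y\<close> is still nonnegative. The resulting
  estimate makes the slice \<open>y \<bullet> b = 1\<close> of the pointed part of the dual cone bounded.
\<close>

lemma rel_interior_dual_cone_bound:
  assumes C: "convex_cone C" and b: "b \<in> rel_interior C"
  obtains e where "0 < e" "\<And>y. y \<in> dual_cone C \<Longrightarrow> y \<in> span C \<Longrightarrow> e * norm y \<le> y \<bullet> b"
proof -
  have hull: "affine hull C = span C"
    using convex_cone_contains_0[OF C] by (simp add: affine_hull_span_0 hull_inc)
  obtain e where e: "0 < e" "cball b e \<inter> span C \<subseteq> C" and "b \<in> C"
    using b by (auto simp: rel_interior_cball hull)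
  have "e * norm y \<le> y \<bullet> b" if y: "y \<in> dual_cone C" "y \<in> span C" for y
  proof (cases "y = 0")
    case False
    have "b - (e / norm y) *\<^sub>R y \<in> cball b e"
      using e(1) False by (simp add: dist_norm)
    moreover have "b - (e / norm y) *\<^sub>R y \<in> span C"
      using y \<open>b \<in> C\<close> by (simp add: span_diff span_scale span_base)
    ultimately have "b - (e / norm y) *\<^sub>R y \<in> C"
      using e(2) by blast
    then have "0 \<le> y \<bullet> (b - (e / norm y) *\<^sub>R y)"
      using y(1) unfolding mem_dual_cone by blast
    also have "\<dots> = y \<bullet> b - e * norm y"
      using False by (simp add: inner_simps dot_square_norm power2_eq_square)
    finally show ?thesis
      by simp
  qed simp
  with e(1) that show ?thesis
    by blast
qed

text \<open>
  The part of \<open>y\<close> in the span of the cone vanishes by the preceding estimate.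
\<close>

lemma orthogonal_comp_if_zero_on_rel_interior:
  assumes C: "convex_cone C" and b: "b \<in> rel_interior C"
    and y: "y \<in> dual_cone C" "y \<bullet> b = 0"
  shows "y \<in> C\<^sup>\<bottom>"
proof -
  obtain d l where dl: "y = d + l" "d \<in> dual_cone C" "d \<in> span C" "l \<in> C\<^sup>\<bottom>"
    using dual_cone_decomposition y(1) by blast
  obtain e where e: "0 < e" "e * norm d \<le> d \<bullet> b"
    using rel_interior_dual_cone_bound[OF C b] dl by metis
  have "l \<bullet> b = 0"
    using dl b rel_interior_subset by (auto simp: mem_orthogonal_comp)
  then have "d \<bullet> b = 0"
    using dl y by (simp add: inner_simps)
  with e have "d = 0"
    by (simp add: mult_le_0_iff)
  with dl show ?thesis
    by simp
qed

section \<open>Faces of cones\<close>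

lemma convex_cone_cone_face:
  assumes "convex_cone C" "E cone_face_of C"
  shows "convex_cone E"
  using assms face_of_conic[of C E]
  by (auto simp: cone_face_of_def convex_cone_def face_of_imp_convex)

lemma closed_cone_face:
  fixes C :: "'a::euclidean_space set"
  assumes "closed C" "convex_cone C" "E cone_face_of C"
  shows "closed E"
  using assms face_of_imp_closed[of C E] by (simp add: cone_face_of_def convex_cone_def)

text \<open>
  A point of a segment is the sum of scaled copies of the endpoints, and scaling inside the
  subcone \<open>E\<close> can be undone.
\<close>

lemma cone_faceI:
  assumes C: "convex_cone C" and E: "convex_cone E" "E \<subseteq> C"
    and summand: "\<And>x y. x \<in> C \<Longrightarrow> y \<in> C \<Longrightarrow> x + y \<in> E \<Longrightarrow> x \<in> E"
  shows "E cone_face_of C"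
proof -
  have "a \<in> E \<and> b \<in> E"
    if ab: "a \<in> C" "b \<in> C" and x: "x \<in> E" "x \<in> open_segment a b" for a b x
  proof -
    obtain u where u: "0 < u" "u < 1" "x = (1 - u) *\<^sub>R a + u *\<^sub>R b"
      using x by (auto simp: in_segment)
    have au: "(1 - u) *\<^sub>R a \<in> C" and bu: "u *\<^sub>R b \<in> C"
      using ab u convex_cone_scaleR[OF C] by auto
    have "(1 - u) *\<^sub>R a \<in> E"
      using summand[OF au bu] x u by simp
    moreover have "u *\<^sub>R b \<in> E"
      using summand[OF bu au] x u by (simp add: add.commute)
    ultimately show ?thesis
      using convex_cone_scaleR[OF E(1), of "inverse (1 - u)" "(1 - u) *\<^sub>R a"]
        convex_cone_scaleR[OF E(1), of "inverse u" "u *\<^sub>R b"] u by simp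
  qed
  then have "E face_of C"
    using E unfolding face_of_def convex_cone_def by blast
  then show ?thesis
    using convex_cone_nonempty[OF E(1)] by (simp add: cone_face_of_def)
qed

lemma cone_face_Int_orthogonal_comp:
  assumes C: "convex_cone C" and y: "y \<in> dual_cone C"
  shows "C \<inter> {y}\<^sup>\<bottom> cone_face_of C"
proof (rule cone_faceI[OF C])
  show "convex_cone (C \<inter> {y}\<^sup>\<bottom>)"
    using C convex_cone_orthogonal_comp[of "{y}"] by (simp add: convex_cone_iff)
  show "x \<in> C \<inter> {y}\<^sup>\<bottom>" if "x \<in> C" "z \<in> C" "x + z \<in> C \<inter> {y}\<^sup>\<bottom>" for x z
  proof -
    have "0 \<le> y \<bullet> x" "0 \<le> y \<bullet> z"
      using that y by (auto simp: mem_dual_cone)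
    moreover have "y \<bullet> x + y \<bullet> z = 0"
      using that by (simp add: mem_orthogonal_comp inner_commute inner_add_right)
    ultimately have "y \<bullet> x = 0"
      by linarith
    with that(1) show ?thesis
      by (simp add: mem_orthogonal_comp inner_commute)
  qed
qed auto

lemma cone_face_of_trans:
  "G cone_face_of F \<Longrightarrow> F cone_face_of C \<Longrightarrow> G cone_face_of C"
  unfolding cone_face_of_def using face_of_trans by blast

lemma cone_face_eq_Int_span:
  fixes C :: "'a::euclidean_space set"
  assumes C: "convex_cone C" and F: "F cone_face_of C"
  shows "F = C \<inter> span F"
proof -
  have "affine hull F = span F"
    using convex_cone_contains_0[OF convex_cone_cone_face[OF C F]]
    by (simp add: affine_hull_span_0 hull_inc)
  then show ?thesis
    using face_of_imp_eq_affine_Int[of C F] C F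
    by (auto simp: cone_face_of_def convex_cone_def)
qed

section \<open>Nice cones are facially exposed\<close>

text \<open>
  The dual of \<open>K\<^sup>* + F\<^sup>\<bottom>\<close> is \<open>K \<inter> span F = F\<close>, so
  this sum is always dense in the dual cone of \<open>F\<close>.
\<close>

lemma nice_cone_dual_cone_face:
  assumes K: "closed K" "convex_cone K" and nice: "nice_cone K" and F: "F cone_face_of K"
  shows "dual_cone F = dual_cone K + F\<^sup>\<bottom>"
proof
  have "F \<subseteq> K"
    using F by (auto simp: cone_face_of_def dest: face_of_imp_subset)
  then show "dual_cone K + F\<^sup>\<bottom> \<subseteq> dual_cone F"
    by (rule set_plus_subset_dual_cone)
  show "dual_cone F \<subseteq> dual_cone K + F\<^sup>\<bottom>"
  proof
    fix w assume w: "w \<in> dual_cone F"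
    show "w \<in> dual_cone K + F\<^sup>\<bottom>"
    proof (rule ccontr)
      assume "w \<notin> dual_cone K + F\<^sup>\<bottom>"
      moreover have "closed (dual_cone K + F\<^sup>\<bottom>)"
        using nice F by (simp add: nice_cone_def)
      moreover have "convex_cone (dual_cone K + F\<^sup>\<bottom>)"
        by (intro convex_cone_set_plus convex_cone_dual_cone convex_cone_orthogonal_comp)
      ultimately obtain a where a: "a \<in> dual_cone (dual_cone K + F\<^sup>\<bottom>)" "a \<bullet> w < 0"
        using closed_convex_cone_separation by blast
      have sum: "0 \<le> a \<bullet> (u + v)" if "u \<in> dual_cone K" "v \<in> F\<^sup>\<bottom>" for u v
        using a(1) set_plus_intro[OF that] by (simp add: mem_dual_cone)
      have "a \<in> dual_cone (dual_cone K)"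
        using sum[of _ 0] by (simp add: mem_dual_cone mem_orthogonal_comp)
      then have "a \<in> K"
        using dual_cone_dual_cone[OF K] by simp
      moreover have "a \<in> span F"
      proof -
        obtain d l where dl: "d \<in> span F" "\<And>x. x \<in> span F \<Longrightarrow> orthogonal l x" "a = d + l"
          using orthogonal_subspace_decomp_exists[of F a] by blast
        then have "l \<in> F\<^sup>\<bottom>"
          by (simp add: mem_orthogonal_comp orthogonal_def span_base)
        then have "- l \<in> F\<^sup>\<bottom>"
          by (simp add: mem_orthogonal_comp)
        then have "0 \<le> a \<bullet> (- l)"
          using sum[of 0 "- l"] by (simp add: mem_dual_cone)
        moreover have "d \<bullet> l = 0"
          using dl by (simp add: orthogonal_def inner_commute)
        ultimately have "l \<bullet> l \<le> 0"
          by (simp add: dl(3) inner_simps)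
        then have "l = 0"
          using inner_ge_zero[of l] by (simp add: antisym)
        with dl show ?thesis
          by simp
      qed
      ultimately have "a \<in> F"
        using cone_face_eq_Int_span[OF K(2) F] by blast
      with w a(2) show False
        by (force simp: mem_dual_cone inner_commute)
    qed
  qed
qed

text \<open>
  A supporting hyperplane of \<open>E\<close> at a relatively interior point of \<open>F\<close>
  contains all of \<open>F\<close>.
\<close>

lemma proper_cone_face_supporting:
  fixes E :: "'a::euclidean_space set"
  assumes E: "convex_cone E" and F: "F cone_face_of E" and "F \<noteq> E"
  obtains a where "a \<in> dual_cone E" "a \<in> F\<^sup>\<bottom>" "a \<notin> E\<^sup>\<bottom>"
proof -
  have cF: "convex_cone F"
    using convex_cone_cone_face[OF E F] .
  then obtain p where p: "p \<in> rel_interior F"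
    using rel_interior_eq_empty[of F] by (auto simp: convex_cone_def)
  have FE: "F face_of E" and "F \<subseteq> E"
    using F by (auto simp: cone_face_of_def dest: face_of_imp_subset)
  have pF: "p \<in> F"
    using p rel_interior_subset by blast
  then have p_boundary: "p \<in> E" "p \<notin> rel_interior E"
    using face_of_disjoint_rel_interior[OF FE \<open>F \<noteq> E\<close>] \<open>F \<subseteq> E\<close> by blast+
  have "convex E"
    using E by (simp add: convex_cone_def)
  then obtain a where a: "\<And>y. y \<in> E \<Longrightarrow> a \<bullet> p \<le> a \<bullet> y"
      "\<And>y. y \<in> rel_interior E \<Longrightarrow> a \<bullet> p < a \<bullet> y"
    using supporting_hyperplane_rel_boundary[OF \<open>convex E\<close> p_boundary] by metis
  have "2 *\<^sub>R p \<in> E"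
    using E pF \<open>F \<subseteq> E\<close> by (auto intro: convex_cone_scaleR)
  then have ap: "a \<bullet> p = 0"
    using a(1)[of 0] a(1)[of "2 *\<^sub>R p"] convex_cone_contains_0[OF E] by auto
  then have aE: "a \<in> dual_cone E"
    using a(1) by (simp add: mem_dual_cone)
  then have "a \<in> F\<^sup>\<bottom>"
    using orthogonal_comp_if_zero_on_rel_interior[OF cF p _ ap] dual_cone_antimono[OF \<open>F \<subseteq> E\<close>]
    by blast
  moreover have "a \<notin> E\<^sup>\<bottom>"
  proof -
    obtain q where q: "q \<in> rel_interior E"
      using rel_interior_eq_empty[of E] E by (auto simp: convex_cone_def)
    then have "q \<in> E" "a \<bullet> q \<noteq> 0"
      using a(2)[OF q] ap rel_interior_subset[of E] by auto
    then show ?thesis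
      by (auto simp: mem_orthogonal_comp)
  qed
  ultimately show ?thesis
    using that aE by blast
qed

text \<open>
  A relatively interior functional \<open>y\<close> of \<open>K\<^sup>* \<inter> F\<^sup>\<bottom>\<close>
  exposes the smallest exposed face \<open>E\<close> containing \<open>F\<close>. If \<open>F\<close>
  were smaller, some functional in the dual of \<open>E\<close> would vanish on \<open>F\<close>
  but not on \<open>E\<close>. Niceness at \<open>E\<close> changes it, without altering its values on
  \<open>E\<close>, into a member of \<open>K\<^sup>*\<close>, which would expose a smaller face still
  containing \<open>F\<close>.
\<close>

proposition nice_cone_imp_facially_exposed:
  assumes K: "closed K" "convex_cone K" and nice: "nice_cone K"
  shows "facially_exposed K"
  unfolding facially_exposed_def
proof (intro allI impI)
  fix F assume F: "F cone_face_of K"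
  define M where "M = dual_cone K \<inter> F\<^sup>\<bottom>"
  have M: "convex_cone M"
    using convex_cone_dual_cone[of K] convex_cone_orthogonal_comp[of F]
    by (simp add: M_def convex_cone_iff)
  then obtain y where y: "y \<in> rel_interior M"
    using rel_interior_eq_empty[of M] by (auto simp: convex_cone_def)
  then have yM: "y \<in> dual_cone K" "y \<in> F\<^sup>\<bottom>"
    using rel_interior_subset[of M] by (auto simp: M_def)
  define E where "E = K \<inter> {y}\<^sup>\<bottom>"
  have E: "E cone_face_of K"
    unfolding E_def by (rule cone_face_Int_orthogonal_comp[OF K(2) yM(1)])
  have FK: "F face_of K" "F \<noteq> {}"
    using F by (auto simp: cone_face_of_def)
  have "F \<subseteq> E"
    using face_of_imp_subset[OF FK(1)] yM
    by (auto simp: E_def mem_orthogonal_comp inner_commute)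
  then have FE: "F cone_face_of E"
    using face_of_subset[OF FK(1), of E] FK(2) by (auto simp: cone_face_of_def E_def)
  have M_perp: "u \<in> E\<^sup>\<bottom>" if u: "u \<in> M" for u
  proof -
    have "u \<bullet> x = 0" if x: "x \<in> E" for x
    proof -
      have "x \<in> dual_cone M" "x \<bullet> y = 0"
        using x by (auto simp: E_def M_def mem_dual_cone mem_orthogonal_comp inner_commute)
      then have "x \<in> M\<^sup>\<bottom>"
        using orthogonal_comp_if_zero_on_rel_interior[OF M y] by blast
      with u show ?thesis
        by (simp add: mem_orthogonal_comp inner_commute)
    qed
    then show ?thesis
      by (simp add: mem_orthogonal_comp)
  qed
  have "F = E"
  proof (rule ccontr)
    assume "F \<noteq> E"
    then obtain a where a: "a \<in> dual_cone E" "a \<in> F\<^sup>\<bottom>" "a \<notin> E\<^sup>\<bottom>"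
      using proper_cone_face_supporting[OF convex_cone_cone_face[OF K(2) E] FE] by blast
    then obtain u v where uv: "a = u + v" "u \<in> dual_cone K" "v \<in> E\<^sup>\<bottom>"
      using nice_cone_dual_cone_face[OF K nice E] by (auto elim: set_plus_elim)
    have "u \<in> F\<^sup>\<bottom>"
      using a(2) uv(3) \<open>F \<subseteq> E\<close> unfolding uv(1)
      by (force simp: mem_orthogonal_comp inner_add_left)
    then have "u \<in> E\<^sup>\<bottom>"
      using uv M_perp by (simp add: M_def)
    then show False
      using a(3) uv by (simp add: mem_orthogonal_comp inner_simps)
  qed
  then show "F cone_exposed_face_of K"
    using F yM by (auto simp: cone_exposed_face_of_def E_def)
qed

section \<open>Generating a dual cone by properly minimal faces\<close>

lemma extreme_point_of_base_summand:
  assumes D: "convex_cone D" and pos: "\<And>d. d \<in> D \<Longrightarrow> d \<noteq> 0 \<Longrightarrow> 0 < d \<bullet> b"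
    and e: "e extreme_point_of {d \<in> D. d \<bullet> b = 1}"
    and d: "d \<in> D" "d' \<in> D" "d + d' = t *\<^sub>R e"
  shows "\<exists>s\<ge>0. d = s *\<^sub>R e"
proof -
  have eb: "e \<bullet> b = 1"
    using e by (simp add: extreme_point_of_def)
  have t: "d \<bullet> b + d' \<bullet> b = t"
    using arg_cong[OF d(3), of "\<lambda>x. x \<bullet> b"] eb by (simp add: inner_simps)
  consider "d = 0" | "d' = 0" "d \<noteq> 0" | "d \<noteq> 0" "d' \<noteq> 0"
    by blast
  then show ?thesis
  proof cases
    case 1
    then show ?thesis
      by (intro exI[of _ 0]) simp
  next
    case 2
    then show ?thesis
      using d t pos[of d] by (intro exI[of _ t]) auto
  next
    case 3
    define r r' where "r = d \<bullet> b" and "r' = d' \<bullet> b"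
    have r: "0 < r" "0 < r'" "r + r' = t"
      using 3 d pos t by (auto simp: r_def r'_def)
    have base: "d /\<^sub>R r \<in> {d \<in> D. d \<bullet> b = 1}" "d' /\<^sub>R r' \<in> {d \<in> D. d \<bullet> b = 1}"
      using r d convex_cone_scaleR[OF D] by (auto simp: r_def r'_def)
    have "e = (d + d') /\<^sub>R t"
      using d(3) r by simp
    also have "\<dots> = (1 - r' / t) *\<^sub>R (d /\<^sub>R r) + (r' / t) *\<^sub>R (d' /\<^sub>R r')"
    proof -
      have "1 - r' / t = r / t"
        using r by (simp add: field_simps)
      then show ?thesis
        using r(1,2) by (simp add: scaleR_right_distrib field_simps)
    qed
    finally have comb: "e = (1 - r' / t) *\<^sub>R (d /\<^sub>R r) + (r' / t) *\<^sub>R (d' /\<^sub>R r')" .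
    have "d /\<^sub>R r = d' /\<^sub>R r'"
    proof (rule ccontr)
      assume "d /\<^sub>R r \<noteq> d' /\<^sub>R r'"
      then have "e \<in> open_segment (d /\<^sub>R r) (d' /\<^sub>R r')"
        using comb r unfolding in_segment by (intro conjI exI[of _ "r' / t"]) auto
      with e base show False
        unfolding extreme_point_of_def by blast
    qed
    then have "e = (1 - r' / t + r' / t) *\<^sub>R (d /\<^sub>R r)"
      unfolding scaleR_left_distrib using comb by simp
    then have "e = d /\<^sub>R r"
      by simp
    then show ?thesis
      using r by (intro exI[of _ r]) simp
  qed
qed

text \<open>
  The ray through \<open>e\<close>, thickened by the lineality space, is a face because of
  extremality, and it is minimal because a face containing the lineality space together with
  one further point of it contains \<open>e\<close>.
\<close>

lemma properly_minimal_face_of_extreme_point: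
  assumes pos: "\<And>d. d \<in> dual_cone F \<inter> span F \<Longrightarrow> d \<noteq> 0 \<Longrightarrow> 0 < d \<bullet> b"
    and e: "e extreme_point_of {d \<in> dual_cone F \<inter> span F. d \<bullet> b = 1}"
  shows "{l + t *\<^sub>R e | l t. l \<in> F\<^sup>\<bottom> \<and> 0 \<le> t} properly_minimal_face_of dual_cone F"
    (is "?E properly_minimal_face_of _")
proof -
  let ?D = "dual_cone F \<inter> span F"
  have D: "convex_cone ?D"
    using convex_cone_dual_cone[of F] convex_cone_span[of F] by (simp add: convex_cone_iff)
  have eD: "e \<in> dual_cone F" "e \<in> span F" and eb: "e \<bullet> b = 1"
    using e by (auto simp: extreme_point_of_def)
  have perp: "convex_cone (F\<^sup>\<bottom>)"
    by (rule convex_cone_orthogonal_comp)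
  have span_perp: "x = 0" if "x \<in> span F" "x \<in> F\<^sup>\<bottom>" for x
  proof -
    have "x \<in> (span F)\<^sup>\<bottom>"
      using that(2) by (simp only: orthogonal_comp_span)
    with that(1) have "x \<bullet> x = 0"
      unfolding mem_orthogonal_comp by blast
    then show ?thesis
      by simp
  qed
  have E_cone: "convex_cone ?E"
    unfolding convex_cone_iff
  proof (intro conjI ballI allI impI)
    show "0 \<in> ?E"
      using convex_cone_contains_0[OF perp] by force
    show "x + y \<in> ?E" if "x \<in> ?E" "y \<in> ?E" for x y
    proof -
      obtain l t where 1: "x = l + t *\<^sub>R e" "l \<in> F\<^sup>\<bottom>" "0 \<le> t"
        using \<open>x \<in> ?E\<close> by blast
      obtain m s where 2: "y = m + s *\<^sub>R e" "m \<in> F\<^sup>\<bottom>" "0 \<le> s"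
        using \<open>y \<in> ?E\<close> by blast
      have "x + y = (l + m) + (t + s) *\<^sub>R e"
        using 1 2 by (simp add: algebra_simps)
      then show ?thesis
        using 1 2 convex_cone_add[OF perp, of l m] by (metis (mono_tags, lifting) CollectI add_nonneg_nonneg)
    qed
    show "c *\<^sub>R x \<in> ?E" if "x \<in> ?E" "0 \<le> c" for x c
    proof -
      obtain l t where 1: "x = l + t *\<^sub>R e" "l \<in> F\<^sup>\<bottom>" "0 \<le> t"
        using \<open>x \<in> ?E\<close> by blast
      have "c *\<^sub>R x = c *\<^sub>R l + (c * t) *\<^sub>R e"
        using 1 by (simp add: algebra_simps)
      then show ?thesis
        using 1 \<open>0 \<le> c\<close> convex_cone_scaleR[OF perp, of c l]
        by (metis (mono_tags, lifting) CollectI mult_nonneg_nonneg)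
    qed
  qed
  have E_sub: "?E \<subseteq> dual_cone F"
  proof
    fix x assume "x \<in> ?E"
    then obtain l t where "x = l + t *\<^sub>R e" "l \<in> F\<^sup>\<bottom>" "0 \<le> t"
      by blast
    then show "x \<in> dual_cone F"
      using eD(1) by (simp add: mem_dual_cone mem_orthogonal_comp inner_simps)
  qed
  have perp_sub: "F\<^sup>\<bottom> \<subseteq> ?E"
    by force
  have e_E: "e \<in> ?E"
    using convex_cone_contains_0[OF perp] by (auto intro!: exI[of _ "0::'a"] exI[of _ "1::real"])
  have face: "?E cone_face_of dual_cone F"
  proof (rule cone_faceI[OF convex_cone_dual_cone E_cone E_sub])
    fix x y assume x: "x \<in> dual_cone F" and y: "y \<in> dual_cone F" and xy: "x + y \<in> ?E"
    obtain d l where dl: "x = d + l" "d \<in> dual_cone F" "d \<in> span F" "l \<in> F\<^sup>\<bottom>"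
      using dual_cone_decomposition[OF x] by blast
    obtain d' l' where dl': "y = d' + l'" "d' \<in> dual_cone F" "d' \<in> span F" "l' \<in> F\<^sup>\<bottom>"
      using dual_cone_decomposition[OF y] by blast
    obtain m t where mt: "x + y = m + t *\<^sub>R e" "m \<in> F\<^sup>\<bottom>" "0 \<le> t"
      using xy by blast
    have "d + d' - t *\<^sub>R e = m - l - l'"
      using dl dl' mt by (simp add: algebra_simps)
    moreover have "m - l - l' \<in> F\<^sup>\<bottom>"
      using dl dl' mt by (simp add: mem_orthogonal_comp inner_simps)
    moreover have "d + d' - t *\<^sub>R e \<in> span F"
      using dl dl' eD by (simp add: span_add span_diff span_scale)
    ultimately have "d + d' = t *\<^sub>R e"
      using span_perp by force
    then obtain s where "0 \<le> s" "d = s *\<^sub>R e"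
      using extreme_point_of_base_summand[OF D pos e, of d d' t] dl dl' by blast
    with dl show "x \<in> ?E"
      by (auto simp: add.commute)
  qed
  have "e \<notin> F\<^sup>\<bottom>"
    using span_perp[of e] eD eb by auto
  then have "?E \<noteq> F\<^sup>\<bottom>"
    using e_E by blast
  moreover have False
    if E': "E' cone_face_of dual_cone F" "F\<^sup>\<bottom> \<subset> E'" "E' \<subset> ?E" for E'
  proof -
    have cE': "convex_cone E'"
      using convex_cone_cone_face[OF convex_cone_dual_cone E'(1)] .
    obtain x where x: "x \<in> E'" "x \<notin> F\<^sup>\<bottom>"
      using E'(2) by blast
    then obtain l t where lt: "x = l + t *\<^sub>R e" "l \<in> F\<^sup>\<bottom>" "0 \<le> t"
      using E'(3) by blast
    have "t \<noteq> 0"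
      using x lt by auto
    then have "0 < t"
      using lt by simp
    have "- l \<in> F\<^sup>\<bottom>"
      using lt(2) by (simp add: mem_orthogonal_comp)
    then have "- l \<in> E'"
      using E'(2) by blast
    then have "x + - l \<in> E'"
      using x convex_cone_add[OF cE'] by blast
    then have "t *\<^sub>R e \<in> E'"
      using lt by simp
    then have eE': "e \<in> E'"
      using \<open>0 < t\<close> convex_cone_scaleR[OF cE', of "inverse t" "t *\<^sub>R e"] by simp
    have "?E \<subseteq> E'"
    proof
      fix z assume "z \<in> ?E"
      then obtain m s where "z = m + s *\<^sub>R e" "m \<in> F\<^sup>\<bottom>" "0 \<le> s"
        by blast
      then show "z \<in> E'"
        using E'(2) eE' convex_cone_add[OF cE'] convex_cone_scaleR[OF cE'] by blast
    qed
    with E'(3) show False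
      by blast
  qed
  ultimately show ?thesis
    using face unfolding properly_minimal_face_of_def lspace_dual_cone by blast
qed

text \<open>
  Modulo its lineality space the dual cone is pointed, with a compact base cut out by a
  relatively interior point of \<open>F\<close>; the Krein-Milman theorem generates the base by its
  extreme points. The witness \<open>e\<close> in the hypothesis spans the face modulo the
  lineality space.
\<close>

lemma dual_cone_subset_if_minimal_faces:
  fixes F :: "'a::euclidean_space set"
  assumes F: "convex_cone F" and S: "convex_cone S" "F\<^sup>\<bottom> \<subseteq> S"
    and ray: "\<And>e. e \<in> dual_cone F \<Longrightarrow> e \<notin> F\<^sup>\<bottom> \<Longrightarrow>
      {l + t *\<^sub>R e | l t. l \<in> F\<^sup>\<bottom> \<and> 0 \<le> t} properly_minimal_face_of dual_cone F \<Longrightarrow> e \<in> S"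
  shows "dual_cone F \<subseteq> S"
proof
  fix y assume "y \<in> dual_cone F"
  then obtain d l where dl: "y = d + l" "d \<in> dual_cone F" "d \<in> span F" "l \<in> F\<^sup>\<bottom>"
    using dual_cone_decomposition by blast
  obtain b where b: "b \<in> rel_interior F"
    using rel_interior_eq_empty[of F] F by (auto simp: convex_cone_def)
  have bF: "b \<in> F"
    using b rel_interior_subset by blast
  obtain \<epsilon> where \<epsilon>: "0 < \<epsilon>"
      "\<And>y. y \<in> dual_cone F \<Longrightarrow> y \<in> span F \<Longrightarrow> \<epsilon> * norm y \<le> y \<bullet> b"
    using rel_interior_dual_cone_bound[OF F b] by blast
  let ?D = "dual_cone F \<inter> span F"
  have pos: "0 < x \<bullet> b" if "x \<in> ?D" "x \<noteq> 0" for x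
  proof -
    have "0 < \<epsilon> * norm x"
      using \<epsilon>(1) that by simp
    also have "\<dots> \<le> x \<bullet> b"
      using \<epsilon>(2) that by blast
    finally show ?thesis .
  qed
  define B where "B = {x \<in> ?D. x \<bullet> b = 1}"
  have B_eq: "B = dual_cone F \<inter> span F \<inter> {x. b \<bullet> x = 1}"
    by (auto simp: B_def inner_commute)
  have "closed B"
    unfolding B_eq
    by (intro closed_Int closed_dual_cone closed_span closed_hyperplane)
  moreover have "bounded B"
  proof -
    have "norm x \<le> 1 / \<epsilon>" if "x \<in> B" for x
      using \<epsilon>(2)[of x] \<epsilon>(1) that by (auto simp: B_def field_simps)
    then show ?thesis
      by (auto simp: bounded_iff)
  qed
  ultimately have "compact B"
    by (simp add: compact_eq_bounded_closed)
  moreover have "convex B"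
    unfolding B_eq using convex_cone_dual_cone[of F] convex_cone_span[of F]
    by (intro convex_Int convex_hyperplane) (auto simp: convex_cone_def)
  ultimately have "B = convex hull {e. e extreme_point_of B}"
    by (rule Krein_Milman_Minkowski)
  also have "\<dots> \<subseteq> S"
  proof (rule hull_minimal)
    show "{e. e extreme_point_of B} \<subseteq> S"
    proof clarify
      fix e assume e: "e extreme_point_of B"
      then have "e \<in> B"
        by (simp add: extreme_point_of_def)
      then have "e \<in> dual_cone F" "e \<bullet> b = 1"
        by (simp_all add: B_def)
      then have "e \<in> dual_cone F" "e \<notin> F\<^sup>\<bottom>"
        using bF by (force simp: mem_orthogonal_comp)+
      moreover have "{l + t *\<^sub>R e | l t. l \<in> F\<^sup>\<bottom> \<and> 0 \<le> t} properly_minimal_face_of dual_cone F"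
        using properly_minimal_face_of_extreme_point[OF pos] e unfolding B_def by blast
      ultimately show "e \<in> S"
        by (rule ray)
    qed
    show "convex S"
      using S by (simp add: convex_cone_def)
  qed
  finally have BS: "B \<subseteq> S" .
  have "d \<in> S"
  proof (cases "d = 0")
    case True
    then show ?thesis
      using convex_cone_contains_0[OF S(1)] by simp
  next
    case False
    then have db: "0 < d \<bullet> b"
      using pos dl by blast
    have "d /\<^sub>R (d \<bullet> b) \<in> B"
      using db dl convex_cone_scaleR[OF convex_cone_dual_cone[of F], of "inverse (d \<bullet> b)" d]
      by (simp add: B_def span_scale)
    then have "d /\<^sub>R (d \<bullet> b) \<in> S"
      using BS by blast
    then have "(d \<bullet> b) *\<^sub>R (d /\<^sub>R (d \<bullet> b)) \<in> S"
      using convex_cone_scaleR[OF S(1) less_imp_le[OF db]] by blast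
    then show ?thesis
      using db by simp
  qed
  then show "y \<in> S"
    using dl S convex_cone_add[OF S(1)] by blast
qed

section \<open>Facially exposed cones with exposed minimal dual faces are nice\<close>

text \<open>
  The face \<open>G\<close> of \<open>F\<close> cut out by \<open>e\<close> contains the point \<open>x\<close>
  exposing the ray. A functional \<open>u\<close> exposing \<open>G\<close> as a face of \<open>K\<close>
  then vanishes at \<open>x\<close>, hence lies on the ray modulo \<open>F\<^sup>\<bottom>\<close>; it does
  not vanish on \<open>F\<close>, hence its component along \<open>e\<close> is not zero.
\<close>

lemma exposed_minimal_face_in_sum:
  assumes K: "closed K" "convex_cone K" and exposed: "facially_exposed K"
    and F: "F cone_face_of K" and e: "e \<in> dual_cone F" "e \<notin> F\<^sup>\<bottom>"
    and ray: "{l + t *\<^sub>R e | l t. l \<in> F\<^sup>\<bottom> \<and> 0 \<le> t} cone_exposed_face_of dual_cone F"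
      (is "?E cone_exposed_face_of _")
  shows "e \<in> dual_cone K + F\<^sup>\<bottom>"
proof -
  have cF: "convex_cone F" and "closed F" and "F \<subseteq> K"
    using convex_cone_cone_face[OF K(2) F] closed_cone_face[OF K F] F
    by (auto simp: cone_face_of_def dest: face_of_imp_subset)
  obtain x where x: "x \<in> dual_cone (dual_cone F)" "?E = dual_cone F \<inter> {x}\<^sup>\<bottom>"
    using ray by (auto simp: cone_exposed_face_of_def)
  have "x \<in> F"
    using x(1) dual_cone_dual_cone[OF \<open>closed F\<close> cF] by simp
  have "0 + 1 *\<^sub>R e \<in> ?E"
    using convex_cone_contains_0[OF convex_cone_orthogonal_comp[of F]] zero_le_one by blast
  then have "e \<in> {x}\<^sup>\<bottom>"
    unfolding x(2) by simp
  then have "x \<bullet> e = 0"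
    by (simp add: mem_orthogonal_comp inner_commute)
  define G where "G = F \<inter> {e}\<^sup>\<bottom>"
  have "G cone_face_of K"
    unfolding G_def using cone_face_of_trans[OF cone_face_Int_orthogonal_comp[OF cF e(1)] F] .
  then obtain u where u: "u \<in> dual_cone K" "G = K \<inter> {u}\<^sup>\<bottom>"
    using exposed by (auto simp: facially_exposed_def cone_exposed_face_of_def)
  have "x \<in> G"
    using \<open>x \<in> F\<close> \<open>x \<bullet> e = 0\<close> by (simp add: G_def mem_orthogonal_comp)
  then have "u \<bullet> x = 0"
    using u(2) by (simp add: mem_orthogonal_comp inner_commute)
  then have "u \<in> ?E"
    using u(1) dual_cone_antimono[OF \<open>F \<subseteq> K\<close>] x(2) by (auto simp: mem_orthogonal_comp)
  then obtain l t where lt: "u = l + t *\<^sub>R e" "l \<in> F\<^sup>\<bottom>" "0 \<le> t"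
    by blast
  have "u \<notin> F\<^sup>\<bottom>"
  proof
    assume "u \<in> F\<^sup>\<bottom>"
    then have "F \<subseteq> G"
      using u(2) \<open>F \<subseteq> K\<close> by (auto simp: mem_orthogonal_comp inner_commute)
    then show False
      using e(2) by (auto simp: G_def mem_orthogonal_comp inner_commute)
  qed
  with lt have "t \<noteq> 0"
    by auto
  then have eq: "e = inverse t *\<^sub>R u + (- inverse t) *\<^sub>R l"
    using lt(1) by (simp add: algebra_simps)
  have "inverse t *\<^sub>R u \<in> dual_cone K"
    using u(1) lt(3) by (intro convex_cone_scaleR[OF convex_cone_dual_cone]) auto
  moreover have "(- inverse t) *\<^sub>R l \<in> F\<^sup>\<bottom>"
    using lt(2) by (simp add: mem_orthogonal_comp)
  ultimately show ?thesis
    using set_plus_intro eq by metis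
qed

proposition facially_exposed_imp_nice_cone:
  assumes K: "closed K" "convex_cone K" and exposed: "facially_exposed K"
    and minimal: "\<And>F E. F cone_face_of K \<Longrightarrow> E properly_minimal_face_of dual_cone F \<Longrightarrow>
      E cone_exposed_face_of dual_cone F"
  shows "nice_cone K"
  unfolding nice_cone_def
proof (intro allI impI)
  fix F assume F: "F cone_face_of K"
  have "dual_cone F \<subseteq> dual_cone K + F\<^sup>\<bottom>"
  proof (rule dual_cone_subset_if_minimal_faces)
    show "convex_cone F"
      using convex_cone_cone_face[OF K(2) F] .
    show "convex_cone (dual_cone K + F\<^sup>\<bottom>)"
      by (intro convex_cone_set_plus convex_cone_dual_cone convex_cone_orthogonal_comp)
    have "0 + l \<in> dual_cone K + F\<^sup>\<bottom>" if "l \<in> F\<^sup>\<bottom>" for l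
      using convex_cone_contains_0[OF convex_cone_dual_cone] that by (rule set_plus_intro)
    then show "F\<^sup>\<bottom> \<subseteq> dual_cone K + F\<^sup>\<bottom>"
      by auto
    show "e \<in> dual_cone K + F\<^sup>\<bottom>"
      if "e \<in> dual_cone F" "e \<notin> F\<^sup>\<bottom>"
        "{l + t *\<^sub>R e | l t. l \<in> F\<^sup>\<bottom> \<and> 0 \<le> t} properly_minimal_face_of dual_cone F" for e
      using exposed_minimal_face_in_sum[OF K exposed F] minimal[OF F] that by blast
  qed
  moreover have "dual_cone K + F\<^sup>\<bottom> \<subseteq> dual_cone F"
    using F by (intro set_plus_subset_dual_cone) (auto simp: cone_face_of_def dest: face_of_imp_subset)
  ultimately have "dual_cone K + F\<^sup>\<bottom> = dual_cone F"
    by blast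
  then show "closed (dual_cone K + F\<^sup>\<bottom>)"
    by (simp add: closed_dual_cone)
qed

theorem theorem3:
  fixes K :: "'a::euclidean_space set"
  assumes "closed K" and "convex_cone K"
  shows "(nice_cone K \<longrightarrow> facially_exposed K) \<and>
    (facially_exposed K \<and>
     (\<forall>F. F cone_face_of K \<longrightarrow>
        (\<forall>E. E properly_minimal_face_of dual_cone F \<longrightarrow>
             E cone_exposed_face_of dual_cone F))
     \<longrightarrow> nice_cone K)"
  using nice_cone_imp_facially_exposed[OF assms] facially_exposed_imp_nice_cone[OF assms]
  by blast

end
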